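(* Let $G$ be a connected graph of order $n$ with minimum degree $\delta(G)\ge 2$. If $\gamma_P(G)\ge\frac n5$, then $\operatorname{th}_{\rm pd}^{\times}(G)=\gamma(G)$.
   Context: All graphs are finite, simple and undirected. Let $G$ be a graph. $\gamma(G)$ is the domination number: the minimum $|S|$ over $S\subseteq V(G)$ with $N[S]=V(G)$, where $N[S]$ is the closed neighborhood of $S$. For nonempty $S\subseteq V(G)$ define $P^{[0]}(S)=S$, $P^{[1]}(S)=N[S]$, and for $i\ge 1$, $P^{[i+1]}(S)=P^{[i]}(S)\cup\{w\in V(G)\setminus P^{[i]}(S): \exists u\in P^{[i]}(S),\ N(u)\setminus P^{[i]}(S)=\{w\}\}$. $S$ is a power dominating set if $P^{[t]}(S)=V(G)$ for some $t$; the power domination number $\gamma_P(G)$ is the minimum cardinality of a power dominating set. The power propagation time $\operatorname{pt}_{\rm pd}(G;S)$ is the least positive integer $t$ with $P^{[t]}(S)=V(G)$ (so it is at least $1$, even for $S=V(G)$), and is $\infty$ if $S$ is not a power dominating set. The product power throttling number is $\operatorname{th}_{\rm pd}^{\times}(G)=\min_{\emptyset\ne S\subseteq V(G)}|S|\operatorname{pt}_{\rm pd}(G;S)$. *)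

theory Defs
  imports "Graph_Theory.Digraph_Component" "Graph_Theory.Pair_Digraph" "HOL-Library.Extended_Nat"
begin

text \<open>
  A finite simple undirected graph is a \<open>pair_graph\<close>: a finite loop-free digraph whose set of
  arcs (a set of ordered pairs) is symmetric, so an edge \<open>uv\<close> is the pair of arcs \<open>(u, v)\<close>, \<open>(v, u)\<close>.
\<close>

definition nbhd :: "'a pair_pre_digraph \<Rightarrow> 'a \<Rightarrow> 'a set" where
  "nbhd G v = {w \<in> pverts G. (v, w) \<in> parcs G}"

definition closed_nbhd :: "'a pair_pre_digraph \<Rightarrow> 'a set \<Rightarrow> 'a set" where
  "closed_nbhd G S = S \<union> (\<Union>v\<in>S. nbhd G v)"

text \<open>Each edge at \<open>v\<close> contributes exactly one outgoing arc, so \<open>out_degree\<close> is the degree.\<close>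

definition min_degree :: "'a pair_pre_digraph \<Rightarrow> nat" where
  "min_degree G = Min (out_degree (with_proj G) ` pverts G)"

lemma (in pair_graph) out_degree_eq_card_nbhd: "out_degree (with_proj G) v = card (nbhd G v)"
proof -
  have "out_arcs (with_proj G) v = Pair v ` nbhd G v"
    by (auto simp: out_arcs_def nbhd_def dest: wellformed')
  then show ?thesis
    by (simp add: out_degree_def card_image inj_on_def)
qed

definition dominating_set :: "'a pair_pre_digraph \<Rightarrow> 'a set \<Rightarrow> bool" where
  "dominating_set G S \<longleftrightarrow> S \<subseteq> pverts G \<and> closed_nbhd G S = pverts G"

definition domination_number :: "'a pair_pre_digraph \<Rightarrow> nat" where
  "domination_number G = Min (card ` {S. dominating_set G S})"

text \<open>\<open>observed G S i\<close> is $P^{[i]}(S)$: a domination step followed by zero forcing steps.\<close>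

fun observed :: "'a pair_pre_digraph \<Rightarrow> 'a set \<Rightarrow> nat \<Rightarrow> 'a set" where
  "observed G S 0 = S"
| "observed G S (Suc 0) = closed_nbhd G S"
| "observed G S (Suc (Suc i)) = observed G S (Suc i) \<union>
     {w \<in> pverts G - observed G S (Suc i).
        \<exists>u \<in> observed G S (Suc i). nbhd G u - observed G S (Suc i) = {w}}"

definition power_dominating_set :: "'a pair_pre_digraph \<Rightarrow> 'a set \<Rightarrow> bool" where
  "power_dominating_set G S \<longleftrightarrow>
     S \<noteq> {} \<and> S \<subseteq> pverts G \<and> (\<exists>t. observed G S t = pverts G)"

definition power_domination_number :: "'a pair_pre_digraph \<Rightarrow> nat" where
  "power_domination_number G = Min (card ` {S. power_dominating_set G S})"

definition power_propagation_time :: "'a pair_pre_digraph \<Rightarrow> 'a set \<Rightarrow> enat" where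
  "power_propagation_time G S =
     (if power_dominating_set G S then enat (LEAST t. 0 < t \<and> observed G S t = pverts G) else \<infinity>)"

definition product_power_throttling_number :: "'a pair_pre_digraph \<Rightarrow> enat" where
  "product_power_throttling_number G =
     Min ((\<lambda>S. enat (card S) * power_propagation_time G S) ` {S. S \<noteq> {} \<and> S \<subseteq> pverts G})"

end

theory Submission
  imports Defs
begin

text \<open>
  Observation time 1 means domination, and otherwise the product is at least \<open>2 * \<gamma>\<^sub>P\<close>; so it suffices
  that \<open>\<gamma> \<le> 2 * \<gamma>\<^sub>P\<close>. As \<open>n \<le> 5 * \<gamma>\<^sub>P\<close>, this follows by rounding from the weak form
  \<open>5 * \<gamma> \<le> 2 * n + 4\<close> of the McCuaig--Shepherd theorem, whose additive constant absorbs the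
  exceptional graphs of that theorem.

  For the induction, fix a root \<open>r\<close> and admit \<open>l\<close> vertices of degree at most 1 other than \<open>r\<close>: every
  connected graph satisfies \<open>5 * \<gamma> \<le> 2 * n + l + 4\<close>. Let \<open>w\<close> be a lowest branch vertex of a depth-first
  search tree, so that at least two vertical paths hang below \<open>w\<close>. A hanging path with \<open>m\<close> vertices can be deleted on
  its own unless \<open>m = 2\<close> or \<open>m mod 3 = 1\<close>. If all are of these two kinds, put \<open>w\<close> into the dominating set and
  delete it together with the hanging paths, except that a hanging path \<open>a, b\<close> with \<open>b\<close> not adjacent to \<open>w\<close>
  leaves \<open>b\<close> behind as a new leaf. If the parent of \<open>w\<close> would thereby become a leaf, it is deleted too.
  This fails only for two hanging paths \<open>a, b\<close> and \<open>c, d\<close>, which are deleted entirely with \<open>w\<close>, and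
  possibly its parent, at the cost of two vertices.
\<close>

section \<open>Connectivity, components and paths under an adjacency relation\<close>

locale adjacency =
  fixes E :: "'a \<Rightarrow> 'a \<Rightarrow> bool"
  assumes sym: "E x y \<Longrightarrow> E y x"
    and irrefl: "\<not> E x x"
begin

text \<open>Connectivity by cuts: every proper nonempty part of \<open>V\<close> has an edge to the
  rest. The empty set counts as connected.\<close>

definition conn :: "'a set \<Rightarrow> bool" where
  "conn V \<longleftrightarrow> (\<forall>X\<subseteq>V. X \<noteq> {} \<longrightarrow> (\<forall>x\<in>X. \<forall>y\<in>V - X. \<not> E x y) \<longrightarrow> X = V)"

definition is_path :: "'a list \<Rightarrow> bool" where
  "is_path xs \<longleftrightarrow> xs \<noteq> [] \<and> distinct xs \<and> successively E xs"

text \<open>\<open>D\<close> is not confined to \<open>A\<close>, so that \<open>w\<close> can serve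
  vertices of the paths hanging below it.\<close>

definition dominates :: "'a set \<Rightarrow> 'a set \<Rightarrow> bool" where
  "dominates D A \<longleftrightarrow> (\<forall>v\<in>A. v \<in> D \<or> (\<exists>d\<in>D. E d v))"

definition nb :: "'a set \<Rightarrow> 'a \<Rightarrow> 'a set" where
  "nb V v = {u \<in> V. E v u}"

text \<open>Isolated vertices count as well. Exempting \<open>r\<close> ensures that the start of a
  root path never becomes a new leaf.\<close>

definition leaves :: "'a \<Rightarrow> 'a set \<Rightarrow> 'a set" where
  "leaves r V = {v \<in> V. v \<noteq> r \<and> card (nb V v) \<le> 1}"

definition component :: "'a set \<Rightarrow> 'a \<Rightarrow> 'a set" where
  "component W x = {(u, v). u \<in> W \<and> v \<in> W \<and> E u v}\<^sup>* `` {x}"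

text \<open>By symmetry the complement of a closed set is closed, so only the closed sets containing
  \<open>r\<close> need testing.\<close>

lemma connI:
  assumes "r \<in> V"
    and "\<And>X. X \<subseteq> V \<Longrightarrow> r \<in> X \<Longrightarrow> (\<And>x y. x \<in> X \<Longrightarrow> y \<in> V - X \<Longrightarrow> \<not> E x y) \<Longrightarrow> X = V"
  shows "conn V"
  unfolding conn_def
proof (intro allI impI)
  fix X assume X: "X \<subseteq> V" "X \<noteq> {}" "\<forall>x\<in>X. \<forall>y\<in>V - X. \<not> E x y"
  show "X = V"
  proof (cases "r \<in> X")
    case True
    then show ?thesis using assms(2)[of X] X by blast
  next
    case False
    have "\<not> E x y" if "x \<in> V - X" "y \<in> V - (V - X)" for x y using that X(3) sym by blast
    then have "V - X = V" using assms(1) False by (intro assms(2)) auto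
    then show ?thesis using X by blast
  qed
qed

lemma conn_edge:
  assumes "conn V" "X \<subseteq> V" "X \<noteq> {}" "X \<noteq> V"
  shows "\<exists>x\<in>X. \<exists>y\<in>V - X. E x y"
  using assms unfolding conn_def by blast

lemma component_self: "x \<in> component W x"
  by (simp add: component_def)

lemma component_subset:
  assumes "x \<in> W"
  shows "component W x \<subseteq> W"
proof
  fix y assume "y \<in> component W x"
  then have "(x, y) \<in> {(u, v). u \<in> W \<and> v \<in> W \<and> E u v}\<^sup>*" by (simp add: component_def)
  then show "y \<in> W" using assms by (induction rule: rtrancl_induct) auto
qed

lemma component_closed:
  assumes "y \<in> component W x" "y \<in> W" "z \<in> W" "E y z"
  shows "z \<in> component W x"
  using assms unfolding component_def by (auto intro: rtrancl_into_rtrancl)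

lemma component_eq:
  assumes "y \<in> component W x"
  shows "component W y = component W x"
proof -
  let ?R = "{(u, v). u \<in> W \<and> v \<in> W \<and> E u v}"
  have "sym ?R" using sym by (auto simp: sym_def)
  then have "sym (?R\<^sup>*)" by (rule sym_rtrancl)
  moreover have "(x, y) \<in> ?R\<^sup>*" using assms by (simp add: component_def)
  ultimately have "(y, x) \<in> ?R\<^sup>*" by (simp add: symD)
  with \<open>(x, y) \<in> ?R\<^sup>*\<close> show ?thesis unfolding component_def by (auto intro: rtrancl_trans)
qed

lemma component_disjoint:
  assumes "component W x \<noteq> component W y"
  shows "component W x \<inter> component W y = {}"
  using assms component_eq by blast

lemma conn_component:
  assumes "x \<in> W"
  shows "conn (component W x)"
proof (rule connI)
  show "x \<in> component W x" by (rule component_self)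
next
  fix X assume X: "X \<subseteq> component W x" "x \<in> X"
    and closed: "\<And>u v. u \<in> X \<Longrightarrow> v \<in> component W x - X \<Longrightarrow> \<not> E u v"
  have "y \<in> X" if "y \<in> component W x" for y
  proof -
    have "(x, y) \<in> {(u, v). u \<in> W \<and> v \<in> W \<and> E u v}\<^sup>*" using that by (simp add: component_def)
    then show ?thesis
    proof (induction rule: rtrancl_induct)
      case base
      show ?case by (rule X(2))
    next
      case (step y z)
      then show ?case using X closed component_closed[of y W x z] by auto
    qed
  qed
  then show "X = component W x" using X by blast
qed

lemma conn_path:
  assumes "is_path xs"
  shows "conn (set xs)"
proof -
  have "set xs \<subseteq> X" if "xs \<noteq> []" "successively E xs" "hd xs \<in> X"
    "\<And>x y. x \<in> X \<Longrightarrow> y \<in> set xs - X \<Longrightarrow> \<not> E x y" for X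
    using that
  proof (induction xs rule: induct_list012)
    case (3 x y zs)
    then have "y \<in> X" by auto
    with 3 show ?case by auto
  qed auto
  then show ?thesis using assms by (intro connI[of "hd xs"]) (auto simp: is_path_def)
qed

text \<open>This keeps the graph connected after deletions. A closed part of \<open>W\<close> that
  meets the core \<open>Q\<close> contains all of it. If it missed some of \<open>W\<close>, an edge
  of \<open>V\<close> leaving the missed part would end outside \<open>W\<close>, so its start would
  be adjacent to \<open>Q\<close> after all.\<close>

lemma conn_core:
  assumes "conn V" "W \<subseteq> V" "Q \<subseteq> W" "conn Q" "Q \<noteq> {}"
    and "\<And>v. v \<in> W - Q \<Longrightarrow> nb V v \<subseteq> W \<or> (\<exists>q\<in>Q. E v q)"
  shows "conn W"
proof -
  obtain r where r: "r \<in> Q" using assms by blast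
  show ?thesis
  proof (rule connI)
    show "r \<in> W" using r assms by blast
  next
    fix X assume X: "X \<subseteq> W" "r \<in> X" and closed: "\<And>x y. x \<in> X \<Longrightarrow> y \<in> W - X \<Longrightarrow> \<not> E x y"
    have "Q \<inter> X = Q"
    proof (rule ccontr)
      assume "Q \<inter> X \<noteq> Q"
      then obtain y z where "y \<in> Q \<inter> X" "z \<in> Q - Q \<inter> X" "E y z"
        using conn_edge[OF \<open>conn Q\<close>, of "Q \<inter> X"] r X by blast
      then show False using closed[of y z] assms(3) by blast
    qed
    then have Q: "Q \<subseteq> X" by blast
    show "X = W"
    proof (rule ccontr)
      assume "X \<noteq> W"
      moreover have "W - X \<noteq> V" using r Q X assms by blast
      ultimately obtain y z where yz: "y \<in> W - X" "z \<in> V - (W - X)" "E y z"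
        using conn_edge[of V "W - X"] assms X by blast
      then have "\<not> E y q" if "q \<in> X" for q using closed[OF that] sym by blast
      with yz Q assms(6)[of y] show False unfolding nb_def by blast
    qed
  qed
qed

text \<open>Take the middle vertex of each consecutive triple, and one more vertex for a remainder
  of one or two.\<close>

lemma path_dominated:
  assumes "successively E xs" "distinct xs"
  shows "\<exists>D\<subseteq>set xs. dominates D (set xs) \<and> 3 * card D \<le> length xs + 2"
  using assms
proof (induction "length xs" arbitrary: xs rule: less_induct)
  case less
  consider "xs = []" | x where "xs = [x]" | x y where "xs = [x, y]"
    | x y z zs where "xs = x # y # z # zs"
    by (metis neq_Nil_conv)
  then show ?case
  proof cases
    case 1
    then show ?thesis by (auto simp: dominates_def)
  next
    case 2
    then show ?thesis by (intro exI[of _ "{x}"]) (auto simp: dominates_def)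
  next
    case 3
    then show ?thesis using less by (intro exI[of _ "{x}"]) (auto simp: dominates_def)
  next
    case 4
    then obtain D where D: "D \<subseteq> set zs" "dominates D (set zs)" "3 * card D \<le> length zs + 2"
      using less.hyps[of zs] less.prems by (cases zs) auto
    have "finite D" using D by (auto intro: finite_subset)
    then have "card (insert y D) \<le> Suc (card D)" by (simp add: card_insert_if)
    moreover have "dominates (insert y D) (set xs)"
      using D 4 less.prems sym by (auto simp: dominates_def)
    ultimately show ?thesis using D 4 by (intro exI[of _ "insert y D"]) auto
  qed
qed

lemma path_inner_neighbours:
  assumes "is_path (xs @ [w])" "v \<in> set xs" "v \<noteq> hd (xs @ [w])"
  shows "\<exists>a b. a \<in> set xs \<and> b \<in> set (xs @ [w]) \<and> a \<noteq> b \<and> E v a \<and> E v b"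
proof -
  obtain ys zs where s: "xs = ys @ v # zs" using assms(2) by (auto simp: in_set_conv_decomp)
  then have "ys \<noteq> []" using assms(3) by auto
  then obtain ys' a where a: "ys = ys' @ [a]" by (metis rev_exhaust)
  obtain b zs' where b: "zs @ [w] = b # zs'" by (cases zs) auto
  have xs: "xs @ [w] = ys' @ a # v # b # zs'" using s a b by simp
  then have "E a v" "E v b" "a \<noteq> b"
    using assms(1) unfolding is_path_def by (auto simp: successively_append_iff)
  moreover have "b \<in> set (xs @ [w])" using xs by simp
  ultimately show ?thesis using s a sym by (intro exI[of _ a] exI[of _ b]) auto
qed

lemma two_neighbours:
  assumes "finite W" "a \<in> W" "b \<in> W" "a \<noteq> b" "E v a" "E v b"
  shows "v \<notin> leaves r W"
proof -
  have "card {a, b} \<le> card (nb W v)" using assms by (intro card_mono) (auto simp: nb_def)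
  then show ?thesis using assms by (auto simp: leaves_def)
qed

text \<open>Hence a deletion creates new leaves only among the vertices that lose a
  neighbour.\<close>

lemma leaves_mono:
  assumes "v \<in> leaves r W" "W \<subseteq> V" "nb V v \<subseteq> W"
  shows "v \<in> leaves r V"
proof -
  have "nb V v = nb W v" using assms by (auto simp: nb_def)
  then show ?thesis using assms by (auto simp: leaves_def)
qed

section \<open>Paths hanging below a lowest branch vertex\<close>

definition branching :: "'a set \<Rightarrow> 'a \<Rightarrow> 'a list \<Rightarrow> 'a \<Rightarrow> 'a set set \<Rightarrow> bool" where
  "branching V r P w KS \<longleftrightarrow>
     is_path (P @ [w]) \<and> hd (P @ [w]) = r \<and> set (P @ [w]) \<subseteq> V \<and>
     2 \<le> card KS \<and> pairwise disjnt KS \<and>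
     (\<forall>K\<in>KS. K \<subseteq> V - set (P @ [w]) \<and> (\<forall>x\<in>K. nb V x \<subseteq> K \<union> set (P @ [w])) \<and>
        (\<exists>xs. is_path xs \<and> set xs = K \<and> E w (hd xs))) \<and>
     nb V w \<subseteq> set P \<union> \<Union>KS"

text \<open>In terms of a depth-first search tree, \<open>P @ [w]\<close> is the path from the root to a lowest branch
  vertex \<open>w\<close>, and \<open>KS\<close> are the subtrees below \<open>w\<close>; no tree is constructed.\<close>

lemma path_or_branching:
  assumes "finite V" "conn V" "r \<in> V"
  shows "(\<exists>xs. is_path xs \<and> hd xs = r \<and> set xs = V) \<or> (\<exists>P w KS. branching V r P w KS)"
  using assms
proof (induction "card V" arbitrary: V r rule: less_induct)
  case less
  define W where "W = V - {r}"
  define KS where "KS = component W ` W"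
  have root: "\<exists>y\<in>K. E r y" and sub: "K \<subseteq> W" and con: "conn K"
    and closed: "\<And>x. x \<in> K \<Longrightarrow> nb V x \<subseteq> K \<union> {r}" if K: "K \<in> KS" for K
  proof -
    obtain x where x: "x \<in> W" "K = component W x" using K unfolding KS_def by blast
    show sub: "K \<subseteq> W" using x component_subset by blast
    show "conn K" using x conn_component by blast
    show closed: "nb V z \<subseteq> K \<union> {r}" if "z \<in> K" for z
      using component_closed[of z W x] that sub x unfolding nb_def W_def by blast
    have "x \<in> K" using x component_self by blast
    then obtain y z where "y \<in> K" "z \<in> V - K" "E y z"
      using conn_edge[of V K] less.prems sub unfolding W_def by blast
    then show "\<exists>y\<in>K. E r y" using closed[of y] sym unfolding nb_def by blast
  qed
  have cover: "\<Union>KS = W" using sub component_self unfolding KS_def by blast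
  have fin: "finite KS" using less.prems by (simp add: KS_def W_def)
  have disj: "pairwise disjnt KS"
    unfolding pairwise_def disjnt_def KS_def using component_disjoint by blast
  show ?case
  \<comment> \<open>A branch vertex inside a component of \<open>V - {r}\<close> also serves
    \<open>V\<close>, with \<open>r\<close> prepended to its root path.\<close>
  proof (cases "\<exists>K\<in>KS. \<exists>y P w KS'. E r y \<and> branching K y P w KS'")
    case True
    then obtain K y P w KS' where K: "K \<in> KS" "E r y" and br: "branching K y P w KS'" by blast
    have r: "r \<notin> K" "K \<subseteq> V" using sub[OF K(1)] by (auto simp: W_def)
    have "branching V r (r # P) w KS'"
    proof -
      have "is_path ((r # P) @ [w])"
        using br K r unfolding branching_def is_path_def by (cases P) auto
      moreover have "nb V x \<subseteq> L \<union> set ((r # P) @ [w])" if "L \<in> KS'" "x \<in> L" for L x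
      proof -
        have "x \<in> K" "nb K x \<subseteq> L \<union> set (P @ [w])" using br that unfolding branching_def by blast+
        then show ?thesis using closed[OF K(1)] by (auto simp: nb_def)
      qed
      moreover have "nb V w \<subseteq> set (r # P) \<union> \<Union>KS'"
      proof -
        have "w \<in> K" "nb K w \<subseteq> set P \<union> \<Union>KS'" using br unfolding branching_def by auto
        then show ?thesis using closed[OF K(1)] by (auto simp: nb_def)
      qed
      moreover have "L \<subseteq> V - set ((r # P) @ [w])" if "L \<in> KS'" for L
      proof -
        have "L \<subseteq> K - set (P @ [w])" using br that unfolding branching_def by blast
        then show ?thesis using r by auto
      qed
      moreover have "hd ((r # P) @ [w]) = r" "set ((r # P) @ [w]) \<subseteq> V"
        "2 \<le> card KS'" "pairwise disjnt KS'"
        "\<forall>L\<in>KS'. \<exists>xs. is_path xs \<and> set xs = L \<and> E w (hd xs)"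
        using br r less.prems unfolding branching_def by auto
      ultimately show ?thesis unfolding branching_def by blast
    qed
    then show ?thesis by blast
  next
    case False
    \<comment> \<open>Otherwise the induction hypothesis, with a neighbour of \<open>r\<close> as
      the new root, makes each component a path starting next to \<open>r\<close>. Then
      \<open>V\<close> itself is a path or \<open>r\<close> is the branch vertex, depending on the
      number of components.\<close>
    have ham: "\<exists>xs. is_path xs \<and> set xs = K \<and> E r (hd xs)" if K: "K \<in> KS" for K
    proof -
      obtain y where y: "y \<in> K" "E r y" using root[OF K] by blast
      have "K \<subset> V" using sub[OF K] less.prems by (auto simp: W_def)
      then have "card K < card V" "finite K" using less.prems by (auto intro: psubset_card_mono finite_subset)
      then show ?thesis using less.hyps[OF _ _ con[OF K] y(1)] False K y by blast
    qed
    consider "KS = {}" | K where "KS = {K}" | "2 \<le> card KS"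
      by (metis One_nat_def card_1_singletonE card_eq_0_iff fin leI less_2_cases)
    then show ?thesis
    proof cases
      case 1
      then have "V = {r}" using cover less.prems by (auto simp: W_def)
      then have "is_path [r] \<and> hd [r] = r \<and> set [r] = V" by (simp add: is_path_def)
      then show ?thesis by blast
    next
      case 2
      then obtain xs where xs: "is_path xs" "set xs = K" "E r (hd xs)" using ham by blast
      have "K = V - {r}" using 2 cover W_def by simp
      then have "is_path (r # xs) \<and> hd (r # xs) = r \<and> set (r # xs) = V"
        using xs less.prems by (cases xs) (auto simp: is_path_def)
      then show ?thesis by blast
    next
      case 3
      have "branching V r [] r KS"
        using 3 disj ham sub closed cover less.prems
        unfolding branching_def by (auto simp: is_path_def W_def nb_def irrefl)
      then show ?thesis by blast
    qed
  qed
qed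

section \<open>The inductive bound and its reduction\<close>

definition bounded :: "'a \<Rightarrow> 'a set \<Rightarrow> bool" where
  "bounded r V \<longleftrightarrow> (\<exists>D\<subseteq>V. dominates D V \<and> 5 * card D \<le> 2 * card V + card (leaves r V) + 4)"

text \<open>Amortised accounting: a chosen vertex costs 5, a new leaf costs 1, a deleted vertex pays
  2 and a lost leaf pays 1. A deletion that pays for itself preserves the bound.\<close>

lemma bounded_reduce:
  assumes "finite V" "A \<subseteq> V" "D \<subseteq> V" "dominates D A" "bounded r (V - A)"
    and "5 * card D + card (leaves r (V - A)) \<le> 2 * card A + card (leaves r V)"
  shows "bounded r V"
proof -
  obtain D' where D': "D' \<subseteq> V - A" "dominates D' (V - A)"
    "5 * card D' \<le> 2 * card (V - A) + card (leaves r (V - A)) + 4"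
    using assms(5) unfolding bounded_def by blast
  have "dominates (D \<union> D') V" using assms(4) D'(2) unfolding dominates_def by blast
  moreover have "card (D \<union> D') \<le> card D + card D'" by (rule card_Un_le)
  moreover have "card V = card A + card (V - A)"
    using assms(1,2) by (metis card_Diff_subset card_mono finite_subset le_add_diff_inverse)
  ultimately show ?thesis
    using assms D' unfolding bounded_def by (intro exI[of _ "D \<union> D'"]) auto
qed

text \<open>For a path with \<open>m\<close> vertices, \<open>3 * card D \<le> m + 2\<close> already
  gives \<open>5 * card D \<le> 2 * m + 4\<close>, whatever the leaves.\<close>

lemma bounded_path:
  assumes "is_path xs"
  shows "bounded r (set xs)"
proof -
  obtain D where "D \<subseteq> set xs" "dominates D (set xs)" "3 * card D \<le> length xs + 2"
    using path_dominated assms unfolding is_path_def by blast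
  moreover have "card (set xs) = length xs" using assms by (simp add: is_path_def distinct_card)
  ultimately show ?thesis unfolding bounded_def by (intro exI[of _ D]) auto
qed

end

section \<open>Deletions in a minimal counterexample\<close>

locale minimal_counterexample = adjacency +
  fixes V r P w KS
  assumes fin: "finite V"
    and conn: "conn V"
    and branching: "branching V r P w KS"
    and smaller: "\<And>W. W \<subset> V \<Longrightarrow> conn W \<Longrightarrow> r \<in> W \<Longrightarrow> bounded r W"
    and unbounded: "\<not> bounded r V"
begin

lemma path: "is_path (P @ [w])" "hd (P @ [w]) = r" "set P \<subseteq> V" "w \<in> V" "w \<notin> set P"
  and KS: "2 \<le> card KS" "pairwise disjnt KS"
  and nb_w: "nb V w \<subseteq> set P \<union> \<Union>KS"
  using branching unfolding branching_def by (auto simp: is_path_def)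

lemma finite_KS: "finite KS"
  using KS(1) by (metis card.infinite not_numeral_le_zero)

lemma root: "r \<in> V" "P \<noteq> [] \<Longrightarrow> r = hd P" "P \<noteq> [] \<Longrightarrow> r \<in> set P" "P = [] \<Longrightarrow> r = w"
  using path by (cases P; auto)+

lemma piece:
  assumes "K \<in> KS"
  shows "K \<subseteq> V" "finite K" "w \<notin> K" "K \<inter> set P = {}"
    and "x \<in> K \<Longrightarrow> nb V x \<subseteq> K \<union> set P \<union> {w}"
    and "\<exists>xs. is_path xs \<and> set xs = K \<and> E w (hd xs)"
proof -
  have K: "K \<subseteq> V - set (P @ [w])" "\<forall>x\<in>K. nb V x \<subseteq> K \<union> set (P @ [w])"
    "\<exists>xs. is_path xs \<and> set xs = K \<and> E w (hd xs)"
    using branching assms unfolding branching_def by blast+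
  then show "K \<subseteq> V" "finite K" "w \<notin> K" "K \<inter> set P = {}" using fin by (auto intro: finite_subset)
  show "x \<in> K \<Longrightarrow> nb V x \<subseteq> K \<union> set P \<union> {w}" using K(2) by auto
  show "\<exists>xs. is_path xs \<and> set xs = K \<and> E w (hd xs)" by (rule K(3))
qed

definition T :: "'a set" where
  "T = insert w (\<Union>KS)"

lemma T: "T \<subseteq> V" "T \<inter> set P = {}" "w \<in> T" "finite T"
proof -
  show "T \<subseteq> V" using piece(1) path unfolding T_def by auto
  then show "finite T" using fin by (rule finite_subset)
  show "T \<inter> set P = {}" using piece(4) path(5) unfolding T_def by blast
qed (simp add: T_def)

text \<open>A piece sees only itself, the root path and \<open>w\<close>, while \<open>w\<close>
  sees only the root path and the pieces.\<close>

lemma outside: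
  assumes "v \<in> V" "v \<notin> T" "v \<notin> set P"
  shows "nb V v \<inter> T = {}"
proof (rule ccontr)
  assume "nb V v \<inter> T \<noteq> {}"
  then obtain x where x: "x \<in> T" "v \<in> nb V x" using assms sym by (auto simp: nb_def)
  then consider "x = w" | K where "K \<in> KS" "x \<in> K" unfolding T_def by blast
  then show False
  proof cases
    case 1
    then show ?thesis using nb_w x assms unfolding T_def by blast
  next
    case 2
    then show ?thesis using piece(5) x assms unfolding T_def by blast
  qed
qed

text \<open>A vertex of \<open>Q\<close> other than the root keeps its predecessor and its
  successor, so a surviving root path can acquire a new leaf only at its end.\<close>

lemma inner_not_leaf:
  assumes "is_path (Q @ [q])" "hd (Q @ [q]) = r" "set (Q @ [q]) \<subseteq> W" "finite W" "v \<in> set Q"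
  shows "v \<notin> leaves r W"
proof (cases "v = r")
  case True
  then show ?thesis by (simp add: leaves_def)
next
  case False
  then obtain a b where "a \<in> set Q" "b \<in> set (Q @ [q])" "a \<noteq> b" "E v a" "E v b"
    using path_inner_neighbours[OF assms(1,5)] assms(2) by blast
  then show ?thesis using assms(3,4) two_neighbours[of W a b v] by auto
qed

text \<open>By minimality, no deletion that keeps the root and connectivity can pay for
  itself.\<close>

lemma reduce:
  assumes "A \<subseteq> V" "A \<noteq> {}" "r \<in> V - A" "conn (V - A)" "D \<subseteq> V" "dominates D A"
    and "5 * card D + card (leaves r (V - A)) \<le> 2 * card A + card (leaves r V)"
  shows False
  using assms smaller[of "V - A"] bounded_reduce[of V A D r] fin unbounded by blast

text \<open>Deleting a single hanging path creates no leaf: \<open>w\<close> is the root or keeps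
  its parent and another hanging path, and vertices off the root path lose nothing. Leaves inside
  \<open>K\<close> disappear and pay 1 each.\<close>

lemma remove_component:
  assumes "K \<in> KS" "D \<subseteq> K" "dominates D K"
    and "5 * card D \<le> 2 * card K + card (leaves r V \<inter> K)"
  shows False
proof (rule reduce)
  note K = piece[OF assms(1)]
  have other: "nb V v \<inter> K = {}" if "v \<in> V - K" "v \<notin> set (P @ [w])" for v
    using K(5) that sym by (auto simp: nb_def)
  show "K \<subseteq> V" "D \<subseteq> V" "dominates D K" using K assms by auto
  show "K \<noteq> {}" using K(6) by (auto simp: is_path_def)
  show "r \<in> V - K" using root K by (cases "P = []") auto
  show "conn (V - K)"
  proof (rule conn_core[OF conn])
    show "set (P @ [w]) \<subseteq> V - K" using path K by auto
    show "conn (set (P @ [w]))" using path(1) by (rule conn_path)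
    show "nb V v \<subseteq> V - K \<or> (\<exists>q\<in>set (P @ [w]). E v q)" if "v \<in> V - K - set (P @ [w])" for v
      using other[of v] that by (auto simp: nb_def)
  qed auto
  have "leaves r (V - K) \<subseteq> leaves r V - K"
  proof
    fix v assume v: "v \<in> leaves r (V - K)"
    then have vV: "v \<in> V - K" "v \<noteq> r" by (auto simp: leaves_def)
    have "v \<notin> set P" using inner_not_leaf[OF path(1,2), of "V - K" v] path K fin v by auto
    moreover have "v \<noteq> w"
    proof
      assume "v = w"
      then have "P \<noteq> []" using vV root by auto
      then have p: "last P \<in> set P" "E w (last P)"
        using path(1) sym by (auto simp: is_path_def successively_append_iff)
      have "KS \<noteq> {K}" using KS(1) by auto
      then obtain L where L: "L \<in> KS" "L \<noteq> K" using assms(1) by blast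
      then obtain xs where xs: "is_path xs" "set xs = L" "E w (hd xs)" using piece(6) by blast
      then have h: "hd xs \<in> L" by (auto simp: is_path_def)
      moreover have "L \<inter> K = {}" using KS(2) L assms(1) by (auto simp: pairwise_def disjnt_def)
      ultimately have "hd xs \<in> V - K" using piece(1)[OF L(1)] by blast
      moreover have "last P \<in> V - K" using p(1) K(4) path(3) by blast
      moreover have "hd xs \<noteq> last P" using p(1) h piece(4)[OF L(1)] by (metis disjoint_iff)
      ultimately have "v \<notin> leaves r (V - K)"
        using two_neighbours[of "V - K" "hd xs" "last P" w r] p(2) xs(3) fin \<open>v = w\<close> by blast
      then show False using v by blast
    qed
    ultimately have "v \<in> leaves r V"
      using leaves_mono[OF v, of V] other[of v] vV by (auto simp: nb_def)
    then show "v \<in> leaves r V - K" using vV by blast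
  qed
  moreover have fl: "finite (leaves r V)" using fin by (simp add: leaves_def)
  moreover have "card (leaves r V) = card (leaves r V \<inter> K) + card (leaves r V - K)"
    using fl by (rule card_Int_Diff)
  ultimately have "card (leaves r (V - K)) + card (leaves r V \<inter> K) \<le> card (leaves r V)"
    by (simp add: card_mono)
  then show "5 * card D + card (leaves r (V - K)) \<le> 2 * card K + card (leaves r V)"
    using assms(4) by linarith
qed

text \<open>The deleted set is \<open>A\<close> together with the lower end \<open>R\<close> of the
  root path; the upper part \<open>Q\<close> is the connected core that remains. New leaves can only
  be the leftovers \<open>T - A\<close>, all of which are charged, and \<open>last Q\<close>. The
  assumption on \<open>R\<close> ensures that vertices outside \<open>P\<close> and \<open>T\<close>
  lose no neighbour.\<close>

lemma cut:
  assumes "P = Q @ R" "Q \<noteq> []" "A \<subseteq> T" "w \<in> A"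
    and attached: "\<And>v. v \<in> T - A \<Longrightarrow> \<exists>q\<in>set Q. E v q"
    and inner: "\<And>p. p \<in> set R \<Longrightarrow> nb V p \<subseteq> set P \<union> T"
    and "D \<subseteq> V" "dominates D (A \<union> set R)"
    and "5 * card D + card (T - A) + (if last Q \<in> leaves r (V - (A \<union> set R)) then 1 else 0)
           \<le> 2 * (card A + length R)"
  shows False
proof (rule reduce)
  let ?A = "A \<union> set R"
  have dist: "set Q \<inter> set R = {}" "distinct R" and pathQ: "is_path Q" and hdQ: "hd Q = r"
    using path(1,2) assms(1,2) by (auto simp: is_path_def successively_append_iff)
  have AR: "A \<inter> set P = {}" "finite A" using assms(3) T by (auto intro: finite_subset)
  show "?A \<subseteq> V" using assms(1,3) T path by auto
  show "?A \<noteq> {}" using assms(4) by blast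
  have QA: "set Q \<subseteq> V - ?A" using assms(1) AR dist path by auto
  then show "r \<in> V - ?A" using hdQ assms(2) by (metis hd_in_set subsetD)
  have other: "nb V v \<subseteq> V - ?A" if "v \<in> V - ?A - set Q" "v \<notin> T" for v
  proof -
    have "v \<notin> set P" using that assms(1) by auto
    then have "nb V v \<inter> T = {}" using outside that by blast
    moreover have "nb V v \<inter> set R = {}"
      using inner sym that \<open>v \<notin> set P\<close> by (fastforce simp: nb_def)
    ultimately show ?thesis using assms(3) by (auto simp: nb_def)
  qed
  show "conn (V - ?A)"
  proof (rule conn_core[OF conn _ QA conn_path[OF pathQ]])
    show "nb V v \<subseteq> V - ?A \<or> (\<exists>q\<in>set Q. E v q)" if "v \<in> V - ?A - set Q" for v
      using that other attached[of v] by blast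
  qed (use assms(2) in auto)
  show "D \<subseteq> V" "dominates D ?A" by fact+
  have "leaves r (V - ?A) \<subseteq> leaves r V \<union> (T - A) \<union> ({last Q} \<inter> leaves r (V - ?A))"
  proof
    fix v assume v: "v \<in> leaves r (V - ?A)"
    then have vV: "v \<in> V - ?A" "v \<noteq> r" by (auto simp: leaves_def)
    have Q: "Q = butlast Q @ [last Q]" using assms(2) by simp
    have "v \<notin> set (butlast Q)"
      using inner_not_leaf[of "butlast Q" "last Q" "V - ?A" v] pathQ hdQ QA fin v Q by auto
    moreover have "v \<in> leaves r V" if "v \<notin> set Q" "v \<notin> T"
      using leaves_mono[OF v, of V] other[of v] vV that by auto
    moreover have "set Q = insert (last Q) (set (butlast Q))"
      by (subst Q) simp
    ultimately show "v \<in> leaves r V \<union> (T - A) \<union> ({last Q} \<inter> leaves r (V - ?A))"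
      using v vV by blast
  qed
  moreover have "finite (leaves r V)" "finite (T - A)" using fin T by (auto simp: leaves_def)
  ultimately have "card (leaves r (V - ?A)) \<le> card (leaves r V \<union> (T - A) \<union> ({last Q} \<inter> leaves r (V - ?A)))"
    by (intro card_mono) auto
  also have "\<dots> \<le> card (leaves r V) + card (T - A) + card ({last Q} \<inter> leaves r (V - ?A))"
    by (meson add_right_mono card_Un_le order_trans)
  also have "card ({last Q} \<inter> leaves r (V - ?A)) = (if last Q \<in> leaves r (V - ?A) then 1 else 0)" by auto
  finally have "card (leaves r (V - ?A)) \<le> card (leaves r V) + card (T - A)
    + (if last Q \<in> leaves r (V - ?A) then 1 else 0)" .
  moreover have "card ?A = card A + length R"
    using AR dist assms(1) by (subst card_Un_disjoint) (auto simp: distinct_card)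
  ultimately show "5 * card D + card (leaves r (V - ?A)) \<le> 2 * card ?A + card (leaves r V)"
    using assms(9) by (cases "last Q \<in> leaves r (V - ?A)") simp_all
qed

text \<open>\<open>A\<close> is deleted together with \<open>w\<close>, the vertices of \<open>K - A\<close> stay behind as possible new leaves.\<close>

definition shrinks :: "'a set \<Rightarrow> 'a set \<Rightarrow> 'a set \<Rightarrow> bool" where
  "shrinks K A D \<longleftrightarrow> A \<subseteq> K \<and> D \<subseteq> K \<and> dominates (insert w D) A \<and>
     (\<forall>b\<in>K - A. \<exists>q\<in>set P. E b q) \<and>
     (5 * card D + card (K - A) + 2 \<le> 2 * card A \<or>
      (\<exists>a b. K = {a, b} \<and> A = {a} \<and> D = {} \<and> a \<noteq> b \<and> E w a \<and> E a b))"

text \<open>If the length is 1 modulo 3, \<open>w\<close> takes care of the head and the rest splits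
  into triples. Otherwise \<open>remove_component\<close> would apply unless the path has exactly
  two vertices and contains no leaf.\<close>

lemma shrinks_exists:
  assumes "K \<in> KS"
  shows "\<exists>A D. shrinks K A D"
proof -
  note K = piece[OF assms]
  obtain xs where xs: "is_path xs" "set xs = K" "E w (hd xs)" using K(6) by blast
  have card: "card K = length xs" using xs by (auto simp: is_path_def distinct_card)
  show ?thesis
  proof (cases "length xs mod 3 = 1")
    case True
    obtain x ys where s: "xs = x # ys" using xs by (cases xs) (auto simp: is_path_def)
    obtain D where D: "D \<subseteq> set ys" "dominates D (set ys)" "3 * card D \<le> length ys + 2"
      using path_dominated[of ys] xs s by (cases ys) (auto simp: is_path_def)
    have "length ys mod 3 = 0" using True s by (simp add: mod_Suc split: if_splits)
    then have "3 * card D \<le> length ys" using D(3) by presburger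
    then have "5 * card D + card (K - K) + 2 \<le> 2 * card K" using card s by simp
    moreover have "dominates (insert w D) K" using D(2) xs s by (auto simp: dominates_def)
    ultimately have "shrinks K K D" using D(1) xs(2) s unfolding shrinks_def by auto
    then show ?thesis by blast
  next
    case False
    obtain D where D: "D \<subseteq> K" "dominates D K" "3 * card D \<le> length xs + 2"
      using path_dominated[of xs] xs by (auto simp: is_path_def)
    have "5 * card D > 2 * card K + card (leaves r V \<inter> K)"
      using remove_component[OF assms D(1,2)] leI by blast
    then have small: "5 * card D > 2 * length xs + card (leaves r V \<inter> K)" using card by simp
    \<comment> \<open>With \<open>3 * k\<close> vertices the cost \<open>5 * k\<close> is covered by
      \<open>6 * k\<close>; with \<open>3 * k + 2\<close> vertices the cost \<open>5 * k + 5\<close>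
      exceeds \<open>6 * k + 4\<close> only for \<open>k = 0\<close>.\<close>
    then have "length xs = 2" using D(3) False by presburger
    then obtain a b where ab: "xs = [a, b]" by (auto simp: length_Suc_conv numeral_2_eq_2)
    then have Kab: "K = {a, b}" "a \<noteq> b" "E w a" "E a b" using xs by (auto simp: is_path_def)
    have "leaves r V \<inter> K = {}"
    proof (rule ccontr)
      assume "leaves r V \<inter> K \<noteq> {}"
      moreover have "finite (leaves r V \<inter> K)" using K(2) by simp
      ultimately have "card (leaves r V \<inter> K) > 0" by (simp add: card_gt_0_iff)
      moreover have "card D \<le> 1" using D(3) ab by simp
      ultimately show False using small ab by simp
    qed
    \<comment> \<open>The root is exempt from \<open>leaves\<close>, so it has to be ruled out
      before \<open>b\<close> is known to have a second neighbour. That neighbour is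
      \<open>w\<close> or lies on the root path.\<close>
    moreover have "b \<noteq> r" using root K Kab by (cases "P = []") auto
    ultimately have "card (nb V b) > 1" using Kab K(1) by (auto simp: leaves_def)
    then have "\<not> nb V b \<subseteq> {a}" by (metis card_mono finite.emptyI finite_insert is_singletonI is_singleton_altdef leD)
    then obtain c where c: "c \<in> nb V b" "c \<noteq> a" by blast
    then have "c \<noteq> b" "E b c" using irrefl by (auto simp: nb_def)
    show ?thesis
    proof (cases "E w b")
      case True
      then have "shrinks K K {}" using Kab unfolding shrinks_def dominates_def by simp
      then show ?thesis by blast
    next
      case False
      then have "c \<noteq> w" using \<open>E b c\<close> sym by blast
      then have "c \<in> set P" using K(5)[of b] c Kab \<open>c \<noteq> b\<close> by blast
      then have "shrinks K {a} {}"
        using Kab \<open>E b c\<close> unfolding shrinks_def dominates_def by auto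
      then show ?thesis by blast
    qed
  qed
qed

text \<open>Either alternative of \<open>shrinks\<close> gains at least 1 per piece, and the first
  gains at least 2. The vertex \<open>w\<close> costs 5 and pays 2, which gives the constant
  3.\<close>

lemma shrinks_sums:
  assumes shr: "\<And>K. K \<in> KS \<Longrightarrow> shrinks K (A K) (D K)"
  defines "U \<equiv> insert w (\<Union>K\<in>KS. A K)"
    and "C \<equiv> insert w (\<Union>K\<in>KS. D K)"
  shows "U \<subseteq> T" "C \<subseteq> T" "dominates C U" "T - U \<subseteq> (\<Union>K\<in>KS. K - A K)"
    and "5 * card C + card (T - U) + card KS \<le> 2 * card U + 3"
    and "K \<in> KS \<Longrightarrow> 5 * card (D K) + card (K - A K) + 2 \<le> 2 * card (A K) \<Longrightarrow>
           5 * card C + card (T - U) + card KS + 1 \<le> 2 * card U + 3"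
proof -
  have sub: "A K \<subseteq> K" "D K \<subseteq> K" "dominates (insert w (D K)) (A K)" if "K \<in> KS" for K
    using shr[OF that] by (auto simp: shrinks_def)
  show "U \<subseteq> T" using sub(1) unfolding U_def T_def by blast
  show "C \<subseteq> T" using sub(2) unfolding C_def T_def by blast
  show "dominates C U"
    unfolding dominates_def
  proof
    fix v assume "v \<in> U"
    then consider "v = w" | K where "K \<in> KS" "v \<in> A K" unfolding U_def by blast
    then show "v \<in> C \<or> (\<exists>d\<in>C. E d v)"
    proof cases
      case 2
      then have "v \<in> insert w (D K) \<or> (\<exists>d\<in>insert w (D K). E d v)"
        using sub(3) unfolding dominates_def by blast
      then show ?thesis using \<open>K \<in> KS\<close> unfolding C_def by blast
    qed (simp add: C_def)
  qed
  show TU: "T - U \<subseteq> (\<Union>K\<in>KS. K - A K)" unfolding U_def T_def by blast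
  have fK: "finite K" if "K \<in> KS" for K using piece(2) that .
  have fA: "finite (A K)" if "K \<in> KS" for K using sub(1) fK that by (blast intro: finite_subset)
  have disj: "A K \<inter> A L = {}" if "K \<in> KS" "L \<in> KS" "K \<noteq> L" for K L
    using KS(2) sub(1)[of K] sub(1)[of L] that unfolding pairwise_def disjnt_def by blast
  have "w \<notin> (\<Union>K\<in>KS. A K)" using piece(3) sub(1) by blast
  then have cU: "card U = 1 + (\<Sum>K\<in>KS. card (A K))"
    using fA disj finite_KS unfolding U_def by (simp add: card_UN_disjoint)
  have "card C \<le> 1 + card (\<Union>K\<in>KS. D K)" unfolding C_def by (simp add: card_insert_le_m1 card_insert_if)
  then have cC: "card C \<le> 1 + (\<Sum>K\<in>KS. card (D K))"
    using card_UN_le[OF finite_KS, of D] by linarith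
  have "card (T - U) \<le> card (\<Union>K\<in>KS. K - A K)"
    using TU fK finite_KS by (intro card_mono) auto
  then have cT: "card (T - U) \<le> (\<Sum>K\<in>KS. card (K - A K))"
    using card_UN_le[OF finite_KS, of "\<lambda>K. K - A K"] by linarith
  define f g where "f K = 5 * card (D K) + card (K - A K) + 1" and "g K = 2 * card (A K)" for K
  have fg: "f K \<le> g K" if "K \<in> KS" for K
    using shr[OF that] unfolding f_def g_def shrinks_def by fastforce
  have sf: "sum f KS = 5 * (\<Sum>K\<in>KS. card (D K)) + (\<Sum>K\<in>KS. card (K - A K)) + card KS"
    unfolding f_def sum.distrib by (simp add: sum_distrib_left)
  have sg: "sum g KS = 2 * (\<Sum>K\<in>KS. card (A K))"
    unfolding g_def by (simp add: sum_distrib_left)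
  have "sum f KS \<le> sum g KS" using fg by (rule sum_mono)
  then show "5 * card C + card (T - U) + card KS \<le> 2 * card U + 3"
    using sf sg cU cC cT by linarith
  assume "K \<in> KS" "5 * card (D K) + card (K - A K) + 2 \<le> 2 * card (A K)"
  then have "f K < g K" by (simp add: f_def g_def)
  then have "sum f KS < sum g KS" using fg \<open>K \<in> KS\<close> finite_KS by (intro sum_strict_mono_ex1) auto
  then show "5 * card C + card (T - U) + card KS + 1 \<le> 2 * card U + 3"
    using sf sg cU cC cT by linarith
qed

text \<open>If the parent \<open>p\<close> of \<open>w\<close> would become a leaf, it is deleted along with \<open>A\<close>.\<close>

lemma cut_with_parent:
  assumes P: "P = Q @ [p]" and A: "A \<subseteq> T" "w \<in> A"
    and attached: "\<And>v. v \<in> T - A \<Longrightarrow> \<exists>q\<in>set P. E v q"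
    and leaf: "p \<in> leaves r (V - A)"
  shows "Q \<noteq> []" "nb V p \<subseteq> set P \<union> A"
    and "D \<subseteq> V \<Longrightarrow> dominates D (insert p A) \<Longrightarrow>
           5 * card D + card (T - A) \<le> 2 * card A + 1 \<Longrightarrow> False"
proof -
  have "p \<noteq> r" using leaf by (simp add: leaves_def)
  then show Q: "Q \<noteq> []" using P path(2) by auto
  then have q: "last Q \<in> set Q" "E p (last Q)"
    using path(1) sym unfolding P by (auto simp: is_path_def successively_append_iff)
  have AP: "A \<inter> set P = {}" using T(2) A(1) by blast
  have "card (nb (V - A) p) \<le> 1" using leaf by (simp add: leaves_def)
  moreover have "last Q \<in> nb (V - A) p" using q P AP path(3) by (auto simp: nb_def)
  moreover have "finite (nb (V - A) p)" using fin by (simp add: nb_def)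
  \<comment> \<open>The predecessor on the root path is the only neighbour that \<open>p\<close> can
    keep.\<close>
  ultimately have nbp: "nb (V - A) p \<subseteq> {last Q}"
    by (metis card_le_Suc0_iff_eq One_nat_def insertI1 subsetI singletonD insert_iff)
  then show nbV: "nb V p \<subseteq> set P \<union> A" using q P by (auto simp: nb_def)
  assume D: "D \<subseteq> V" "dominates D (insert p A)" "5 * card D + card (T - A) \<le> 2 * card A + 1"
  show False
  \<comment> \<open>Deleting \<open>p\<close> pays 2 more, of which 1 is reserved for
    \<open>last Q\<close> as a possible new leaf. A leftover adjacent to \<open>p\<close> would be a
    second surviving neighbour of \<open>p\<close>, so all leftovers are attached to
    \<open>Q\<close>.\<close>
  proof (rule cut[OF P Q A])
    fix v assume v: "v \<in> T - A"
    then obtain x where x: "x \<in> set P" "E v x" using attached by blast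
    have "v \<noteq> last Q" using v T(2) q P by auto
    then have "\<not> E p v" using nbp v T(1) by (auto simp: nb_def)
    then show "\<exists>q\<in>set Q. E v q" using x P sym by auto
  qed (use nbV A D in auto)
qed

lemma contradiction: False
proof -
  have "\<forall>K. \<exists>A D. K \<in> KS \<longrightarrow> shrinks K A D" using shrinks_exists by blast
  then obtain A D where AD: "\<And>K. K \<in> KS \<Longrightarrow> shrinks K (A K) (D K)" by metis
  define U C where "U = insert w (\<Union>K\<in>KS. A K)" and "C = insert w (\<Union>K\<in>KS. D K)"
  note s = shrinks_sums(1-5)[OF AD, folded U_def C_def]
  have w: "w \<in> U" "w \<in> C" by (simp_all add: U_def C_def)
  have CV: "C \<subseteq> V" using s(2) T(1) by blast
  have attached: "\<exists>q\<in>set P. E v q" if "v \<in> T - U" for v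
    using that s(4) AD unfolding shrinks_def by blast
  show False
  proof (cases P rule: rev_cases)
    case Nil
    \<comment> \<open>Here \<open>w\<close> is the root: there is no path to which leftovers could
      be attached, so \<open>C\<close> dominates the whole graph.\<close>
    then have "U = T" using attached s(1) by auto
    have "V = T"
    proof (rule ccontr)
      assume "V \<noteq> T"
      then obtain x y where "x \<in> T" "y \<in> V - T" "E x y"
        using conn_edge[OF conn, of T] T by blast
      then show False using outside[of y] Nil T(1) sym by (auto simp: nb_def)
    qed
    then have "bounded r V" using s(3,5) CV \<open>U = T\<close> unfolding bounded_def
      by (intro exI[of _ C]) auto
    then show False using unbounded by blast
  next
    case (snoc Q p)
    have wp: "E w p" using path(1) sym snoc by (auto simp: is_path_def successively_append_iff)
    have pV: "p \<in> V" "p \<notin> T" using snoc path T by auto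
    \<comment> \<open>Otherwise \<open>p\<close> is deleted too. It is dominated by \<open>w\<close>
      at no extra cost, and at least two pieces reduce the constant 3 to the 1 that
      \<open>cut_with_parent\<close> allows.\<close>
    have notleaf: "p \<notin> leaves r (V - U)"
    proof
      assume "p \<in> leaves r (V - U)"
      moreover have "dominates C (insert p U)" using s(3) w wp by (auto simp: dominates_def)
      moreover have "5 * card C + card (T - U) \<le> 2 * card U + 1" using s(5) KS(1) by linarith
      ultimately show False
        using cut_with_parent(3)[OF snoc s(1) w(1) attached] CV by blast
    qed
    have gain: "5 * card C + card (T - U) > 2 * card U"
    proof (rule ccontr)
      assume "\<not> 5 * card C + card (T - U) > 2 * card U"
      then show False
        using cut[of P "[]" U C] attached s(1,3) w CV notleaf snoc by auto
    qed
    then have "card KS = 2" using s(5) KS(1) by linarith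
    then obtain K L where KL: "KS = {K, L}" "K \<noteq> L" by (auto simp: card_2_iff)
    \<comment> \<open>One piece of the first alternative would supply the missing unit, so both
      pieces are paths with two vertices that leave the second one behind.\<close>
    have pair: "\<exists>a b. M = {a, b} \<and> A M = {a} \<and> a \<noteq> b \<and> E w a \<and> E a b" if "M \<in> KS" for M
    proof -
      have "\<not> 5 * card (D M) + card (M - A M) + 2 \<le> 2 * card (A M)"
        using shrinks_sums(6)[of A D M, folded U_def C_def, OF AD that] gain \<open>card KS = 2\<close> by linarith
      then show ?thesis using AD[OF that] unfolding shrinks_def by blast
    qed
    have mem: "K \<in> KS" "L \<in> KS" using KL by simp_all
    obtain a b where ab: "K = {a, b}" "A K = {a}" "a \<noteq> b" "E w a" "E a b"
      using pair[OF mem(1)] by blast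
    obtain c d where cd: "L = {c, d}" "A L = {c}" "c \<noteq> d" "E w c" "E c d"
      using pair[OF mem(2)] by blast
    have "K \<inter> L = {}" using KS(2) KL by (auto simp: pairwise_def disjnt_def)
    moreover have "w \<notin> K" "w \<notin> L" using piece(3) KL by auto
    ultimately have dist: "distinct [w, a, b, c, d]" using ab cd by auto
    have "\<Union>KS = K \<union> L" "(\<Union>M\<in>KS. A M) = A K \<union> A L" by (simp_all add: KL(1))
    then have Teq: "T = {w, a, b, c, d}" and Ueq: "U = {w, a, c}"
      unfolding T_def U_def using ab(1,2) cd(1,2) by auto
    have cT: "card T = 5" using dist Teq by simp
    \<comment> \<open>Deleting all five vertices of \<open>T\<close> at the cost of \<open>a\<close>
      and \<open>c\<close> balances exactly, so it can fail only by making \<open>p\<close> a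
      leaf.\<close>
    have leaf: "p \<in> leaves r (V - T)"
    proof (rule ccontr)
      assume p: "p \<notin> leaves r (V - T)"
      have dom: "dominates {a, c} T" using ab cd sym Teq by (auto simp: dominates_def)
      have ac: "card {a, c} = 2" "{a, c} \<subseteq> V" using dist T(1) Teq by auto
      show False
      proof (rule cut[of P "[]" T "{a, c}"])
        show "dominates {a, c} (T \<union> set [])" using dom by simp
        show "5 * card {a, c} + card (T - T)
            + (if last P \<in> leaves r (V - (T \<union> set [])) then 1 else 0) \<le> 2 * (card T + length [])"
          using p ac(1) cT snoc by simp
      qed (use snoc T(3) ac(2) in simp_all)
    qed
    have last: False if "{x, y} \<subseteq> T" "x \<noteq> y" "dominates {x, y} (insert p T)" for x y
    proof -
      have "card {x, y} = 2" "{x, y} \<subseteq> V" using that T(1) by auto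
      then show False using cut_with_parent(3)[OF snoc subset_refl T(3) _ leaf, of "{x, y}"] that(3) cT by simp
    qed
    \<comment> \<open>Since \<open>p\<close> becomes a leaf when \<open>T\<close> is deleted but not
      when \<open>U\<close> is, it is adjacent to \<open>b\<close> or \<open>d\<close>. That vertex
      dominates \<open>p\<close> and its own piece, and the first vertex of the other piece
      dominates that piece and \<open>w\<close>. So two vertices suffice for \<open>T\<close> and
      \<open>p\<close>.\<close>
    have "\<not> nb V p \<subseteq> set P \<union> U"
    proof
      assume "nb V p \<subseteq> set P \<union> U"
      then have "nb (V - U) p \<subseteq> nb (V - T) p" using T(2) by (auto simp: nb_def)
      moreover have "finite (nb (V - T) p)" using fin by (simp add: nb_def)
      ultimately have "card (nb (V - U) p) \<le> card (nb (V - T) p)" by (rule card_mono[rotated])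
      then show False using notleaf leaf s(1) by (auto simp: leaves_def)
    qed
    then obtain v where "v \<in> nb V p" "v \<notin> set P" "v \<notin> U" by blast
    then have "v \<in> {b, d}" "E v p"
      using cut_with_parent(2)[OF snoc subset_refl T(3) _ leaf] Teq Ueq sym by (auto simp: nb_def)
    then consider "E b p" | "E d p" by blast
    then show False
    proof cases
      case 1
      then have "dominates {b, c} (insert p T)" using ab cd sym Teq by (auto simp: dominates_def)
      then show False using last[of b c] dist Teq by simp
    next
      case 2
      then have "dominates {d, a} (insert p T)" using ab cd sym Teq by (auto simp: dominates_def)
      then show False using last[of d a] dist Teq by auto
    qed
  qed
qed

end

section \<open>The domination bound for connected graphs of minimum degree two\<close>

context adjacency begin

lemma connected_bounded:
  assumes "finite V" "conn V" "r \<in> V"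
  shows "bounded r V"
  using assms
proof (induction "card V" arbitrary: V rule: less_induct)
  case less
  show ?case
  proof (rule ccontr)
    assume unb: "\<not> bounded r V"
    then obtain P w KS where "branching V r P w KS"
      using path_or_branching[OF less.prems] bounded_path by blast
    moreover have "bounded r W" if "W \<subset> V" "conn W" "r \<in> W" for W
      using less.hyps[of W] that less.prems(1) by (auto intro: psubset_card_mono finite_subset)
    ultimately have "minimal_counterexample E V r P w KS"
      using less.prems unb by unfold_locales auto
    then show False by (rule minimal_counterexample.contradiction)
  qed
qed

end

lemma (in pair_graph) adjacency: "adjacency (\<lambda>x y. (x, y) \<in> parcs G)"
  using arcs_symmetric no_loops' by unfold_locales auto

lemma (in pair_graph) connected_imp_conn:
  assumes "Digraph_Component.connected (with_proj G)"
  shows "pverts G \<noteq> {}" "adjacency.conn (\<lambda>x y. (x, y) \<in> parcs G) (pverts G)"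
proof -
  interpret A: adjacency "\<lambda>x y. (x, y) \<in> parcs G" by (rule adjacency)
  \<comment> \<open>Connectedness is defined through the symmetric closure, which changes nothing
    here.\<close>
  have "parcs (mk_symmetric (with_proj G)) = parcs G"
    using arcs_symmetric by (fastforce simp: parcs_mk_symmetric)
  then have sc: "pverts G \<noteq> {}"
    "\<And>u v. u \<in> pverts G \<Longrightarrow> v \<in> pverts G \<Longrightarrow> (u, v) \<in> rtrancl_on (pverts G) (parcs G)"
    using assms by (auto simp: connected_def strongly_connected_def reachable_def)
  show "pverts G \<noteq> {}" by (rule sc(1))
  then obtain r where r: "r \<in> pverts G" by blast
  show "A.conn (pverts G)"
  proof (rule A.connI[OF r])
    fix X assume X: "X \<subseteq> pverts G" "r \<in> X"
      and closed: "\<And>x y. x \<in> X \<Longrightarrow> y \<in> pverts G - X \<Longrightarrow> (x, y) \<notin> parcs G"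
    have "v \<in> X" if "v \<in> pverts G" for v
      using sc(2)[OF r that]
    proof (induction rule: rtrancl_on_induct)
      case base
      show ?case by (rule X(2))
    next
      case (step y z)
      then show ?case using closed by blast
    qed
    then show "X = pverts G" using X by blast
  qed
qed

lemma (in pair_graph) finite_dominating_sets: "finite {S. dominating_set G S}"
  by (rule finite_subset[of _ "Pow (pverts G)"]) (auto simp: dominating_set_def pair_finite_verts)

lemma (in pair_graph) domination_number_le:
  assumes "dominating_set G S"
  shows "domination_number G \<le> card S"
  using assms finite_dominating_sets unfolding domination_number_def by (intro Min_le) auto

lemma (in pair_graph) domination_number_attained:
  "\<exists>S. dominating_set G S \<and> card S = domination_number G"
proof -
  have "dominating_set G (pverts G)"
    by (auto simp: dominating_set_def closed_nbhd_def nbhd_def)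
  then have "domination_number G \<in> card ` {S. dominating_set G S}"
    using finite_dominating_sets unfolding domination_number_def by (intro Min_in) auto
  then show ?thesis by auto
qed

text \<open>Minimum degree two leaves no leaf to be counted in the inductive bound.\<close>

lemma (in pair_graph) domination_number_bound:
  assumes "Digraph_Component.connected (with_proj G)" "min_degree G \<ge> 2"
  shows "5 * domination_number G \<le> 2 * card (pverts G) + 4"
proof -
  interpret A: adjacency "\<lambda>x y. (x, y) \<in> parcs G" by (rule adjacency)
  obtain r where r: "r \<in> pverts G" using connected_imp_conn(1)[OF assms(1)] by blast
  have "A.nb (pverts G) v = nbhd G v" for v by (simp add: A.nb_def nbhd_def)
  moreover have "2 \<le> card (nbhd G v)" if "v \<in> pverts G" for v
  proof -
    have "min_degree G \<le> out_degree (with_proj G) v"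
      unfolding min_degree_def using that pair_finite_verts by (intro Min_le) auto
    then show ?thesis using assms(2) by (simp add: out_degree_eq_card_nbhd)
  qed
  ultimately have "A.leaves r (pverts G) = {}" by (force simp: A.leaves_def)
  moreover have "A.bounded r (pverts G)"
    using A.connected_bounded[OF pair_finite_verts connected_imp_conn(2)[OF assms(1)] r] .
  ultimately obtain D where D: "D \<subseteq> pverts G" "A.dominates D (pverts G)"
    "5 * card D \<le> 2 * card (pverts G) + 4"
    unfolding A.bounded_def by auto
  have "dominating_set G D"
    using D(1,2) unfolding dominating_set_def closed_nbhd_def nbhd_def A.dominates_def by blast
  then show ?thesis using D(3) domination_number_le[of D] by linarith
qed

section \<open>Power domination and product throttling\<close>

lemma (in pair_graph) power_domination_number_le:
  assumes "power_dominating_set G S"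
  shows "power_domination_number G \<le> card S"
proof -
  have "finite {S. power_dominating_set G S}"
    by (rule finite_subset[of _ "Pow (pverts G)"])
      (auto simp: power_dominating_set_def pair_finite_verts)
  then show ?thesis using assms unfolding power_domination_number_def by (intro Min_le) auto
qed

lemma (in pair_graph) power_propagation_time_dominating:
  assumes "dominating_set G S" "S \<noteq> {}"
  shows "power_propagation_time G S = 1"
proof -
  have 1: "observed G S 1 = pverts G" using assms by (simp add: dominating_set_def)
  then have "power_dominating_set G S"
    using assms unfolding power_dominating_set_def dominating_set_def by blast
  moreover have "(LEAST t. 0 < t \<and> observed G S t = pverts G) = 1"
    using 1 by (intro Least_equality) auto
  ultimately show ?thesis by (simp add: power_propagation_time_def one_enat_def)
qed

lemma (in pair_graph) domination_number_le_throttling: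
  assumes "domination_number G \<le> 2 * power_domination_number G" "S \<noteq> {}" "S \<subseteq> pverts G"
  shows "enat (domination_number G) \<le> enat (card S) * power_propagation_time G S"
proof (cases "power_dominating_set G S")
  case False
  \<comment> \<open>A zero factor would turn the infinite propagation time into the product
    0.\<close>
  have "card S \<noteq> 0" using assms(2,3) pair_finite_verts by (auto dest: finite_subset)
  then show ?thesis using False by (simp add: power_propagation_time_def enat_0_iff)
next
  case True
  define t where "t = (LEAST t. 0 < t \<and> observed G S t = pverts G)"
  obtain t0 where t0: "observed G S t0 = pverts G" using True unfolding power_dominating_set_def by blast
  \<comment> \<open>The definition of power domination admits time 0, which means that
    \<open>S\<close> is the whole vertex set; then time 1 works as well.\<close>
  have "\<exists>t>0. observed G S t = pverts G"
  proof (cases t0)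
    case 0
    then have "observed G S 1 = pverts G"
      using t0 by (auto simp: closed_nbhd_def nbhd_def)
    then show ?thesis by blast
  next
    case (Suc m)
    then show ?thesis using t0 by blast
  qed
  then have t: "0 < t \<and> observed G S t = pverts G"
    unfolding t_def by (rule LeastI_ex)
  have "domination_number G \<le> card S * t"
  proof (cases "t = 1")
    case True
    then have "dominating_set G S" using t assms(3) by (simp add: dominating_set_def)
    then show ?thesis using True domination_number_le by simp
  next
    case False
    then have "2 \<le> t" using t by linarith
    then have "power_domination_number G * 2 \<le> card S * t"
      using power_domination_number_le[OF True] by (rule mult_le_mono[rotated])
    then show ?thesis using assms(1) by linarith
  qed
  then show ?thesis using True by (simp add: power_propagation_time_def t_def)
qed

theorem corollary3p12:
  fixes G :: "'a pair_pre_digraph" and n :: nat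
  assumes "pair_graph G"
    and "Digraph_Component.connected (with_proj G)"
    and "n = card (pverts G)"
    and "min_degree G \<ge> 2"
    and "real (power_domination_number G) \<ge> real n / 5"
  shows "product_power_throttling_number G = enat (domination_number G)"
proof -
  interpret pair_graph G by fact
  have "5 * domination_number G \<le> 2 * n + 4" "n \<le> 5 * power_domination_number G"
    using domination_number_bound[OF assms(2,4)] assms(3,5) by linarith+
  \<comment> \<open>The two bounds give \<open>5 * \<gamma> \<le> 10 * \<gamma>\<^sub>P + 4\<close>,
    and integrality removes the 4.\<close>
  then have le: "domination_number G \<le> 2 * power_domination_number G" by linarith
  obtain S where S: "dominating_set G S" "card S = domination_number G"
    using domination_number_attained by blast
  \<comment> \<open>The throttling minimum ranges over nonempty sets only. A minimum dominating set
    is one of them and attains the bound at time 1.\<close>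
  have "S \<noteq> {}" using S(1) connected_imp_conn(1)[OF assms(2)]
    by (auto simp: dominating_set_def closed_nbhd_def)
  then have "enat (domination_number G) = enat (card S) * power_propagation_time G S"
    and "S \<noteq> {} \<and> S \<subseteq> pverts G"
    using S power_propagation_time_dominating by (simp_all add: dominating_set_def)
  moreover have "finite {S. S \<noteq> {} \<and> S \<subseteq> pverts G}"
    using pair_finite_verts by simp
  ultimately show ?thesis
    unfolding product_power_throttling_number_def
    using domination_number_le_throttling[OF le] by (intro Min_eqI) auto
qed

end
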